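(* The price of anarchy of financial network games under priority-proportional strategies is unbounded when firms aim to maximize their total assets: for every $R>0$ there is a financial network (with non-negative external assets, debt contracts only and no default costs) whose game has price of anarchy at least $R$.
   Context: Financial network: firms $v_1,\dots,v_n$; each $v_i$ has external assets $e_i\ge 0$; $v_i$ owes $v_j$ the liability $l_{ij}\ge 0$, with $l_{ii}=0$ (both $l_{ij}>0$ and $l_{ji}>0$ are allowed); $L_i=\sum_j l_{ij}$. Priority-proportional strategy: a strategy $s_i$ of $v_i$ is a complete ordering, allowing ties, of its creditors, i.e. an ordered partition of $\{v_j: l_{ij}>0\}$ into priority classes $1,2,\dots$. Write $L_i^{(m)}$ for the total liability of $v_i$ to its $m$-th class, $k_{ij}$ for the index of the class of $v_i$ containing $v_j$, and $\pi'_{ij}=l_{ij}/L_i^{(k_{ij})}$. Clearing payments consistent with a strategy profile $\mathbf{s}=(s_1,\dots,s_n)$: a matrix $\mathbf{P}=(p_{ij})$ with $p_{ii}=0$, $0\le p_{ij}\le l_{ij}$ and, writing $p_i=\sum_j p_{ij}$, for every $i$: $p_i=\min\{L_i,\,e_i+\sum_j p_{ji}\}$; moreover for every creditor $v_j$ of $v_i$, $$p_{ij}=\min\Big\{\max\Big\{\Big(p_i-\sum_{m=1}^{k_{ij}-1}L_i^{(m)}\Big)\pi'_{ij},\,0\Big\},\,l_{ij}\Big\},$$ and $p_{ij}=0$ if $l_{ij}=0$. Clearing payments are proper if every firm with a positive outgoing payment is reachable, by a (possibly trivial) directed path of edges $(v_i,v_j)$ with $p_{ij}>0$, from some firm with positive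 external assets. Only proper clearing payments are considered. For every profile $\mathbf{s}$ there are maximal ones, denoted $\mathbf{P}(\mathbf{s})$, which are entrywise at least as large as all other proper clearing payments consistent with $\mathbf{s}$. Total assets: $a_i(\mathbf{P})=e_i+\sum_j p_{ji}$. The utility of $v_i$ under $\mathbf{s}$ is $a_i(\mathbf{P}(\mathbf{s}))$. A profile is a (pure) Nash equilibrium if no firm can strictly increase its utility by unilaterally changing its priority-proportional strategy. Social welfare: $SW(\mathbf{P})=\sum_i a_i(\mathbf{P})$; $OPT$ is the maximum of $SW(\mathbf{P}(\mathbf{s}))$ over all strategy profiles. The price of anarchy of an instance possessing at least one Nash equilibrium is the maximum of $OPT/SW(\mathbf{P}(\mathbf{s}))$ over Nash equilibria $\mathbf{s}$. *)

theory Defs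
  imports Complex_Main "HOL-Library.FuncSet" "HOL-Library.Disjoint_Sets"
begin

record network =
  num_firms :: nat
  ext_assets :: "nat \<Rightarrow> real"
  liab :: "nat \<Rightarrow> nat \<Rightarrow> real"

definition firms :: "network \<Rightarrow> nat set" where
  "firms N = {..<num_firms N}"

definition financial_network :: "network \<Rightarrow> bool" where
  "financial_network N \<longleftrightarrow>
     (\<forall>i\<in>firms N. ext_assets N i \<ge> 0) \<and>
     (\<forall>i\<in>firms N. \<forall>j\<in>firms N. liab N i j \<ge> 0) \<and>
     (\<forall>i\<in>firms N. liab N i i = 0)"

definition total_liab :: "network \<Rightarrow> nat \<Rightarrow> real" where
  "total_liab N i = (\<Sum>j\<in>firms N. liab N i j)"

definition creditors :: "network \<Rightarrow> nat \<Rightarrow> nat set" where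
  "creditors N i = {j\<in>firms N. liab N i j > 0}"

text \<open>
  A strategy is the list of its priority classes, highest priority first.  List positions,
  and hence class indices, start at 0 rather than 1.
\<close>

type_synonym strategy = "nat set list"
type_synonym profile = "nat \<Rightarrow> strategy"
type_synonym payments = "nat \<Rightarrow> nat \<Rightarrow> real"

definition strategies :: "network \<Rightarrow> nat \<Rightarrow> strategy set" where
  "strategies N i = {c. distinct c \<and> partition_on (creditors N i) (set c)}"

definition profiles :: "network \<Rightarrow> profile set" where
  "profiles N = (\<Pi>\<^sub>E i\<in>firms N. strategies N i)"

definition class_liab :: "network \<Rightarrow> strategy \<Rightarrow> nat \<Rightarrow> nat \<Rightarrow> real" where
  "class_liab N c i m = (\<Sum>j\<in>c ! m. liab N i j)"

definition class_index :: "strategy \<Rightarrow> nat \<Rightarrow> nat" where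
  "class_index c j = (THE k. k < length c \<and> j \<in> c ! k)"

definition rel_liab :: "network \<Rightarrow> strategy \<Rightarrow> nat \<Rightarrow> nat \<Rightarrow> real" where
  "rel_liab N c i j = liab N i j / class_liab N c i (class_index c j)"

definition out_payment :: "network \<Rightarrow> payments \<Rightarrow> nat \<Rightarrow> real" where
  "out_payment N P i = (\<Sum>j\<in>firms N. P i j)"

definition total_assets :: "network \<Rightarrow> payments \<Rightarrow> nat \<Rightarrow> real" where
  "total_assets N P i = ext_assets N i + (\<Sum>j\<in>firms N. P j i)"

definition priority_share :: "network \<Rightarrow> strategy \<Rightarrow> nat \<Rightarrow> nat \<Rightarrow> real \<Rightarrow> real" where
  "priority_share N c i j x =
     min (max ((x - (\<Sum>m<class_index c j. class_liab N c i m)) * rel_liab N c i j) 0) (liab N i j)"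

text \<open>
  Only the entries of a payment matrix indexed by firms are meaningful; all others are fixed to 0,
  so that equal matrices are equal functions.
\<close>

definition clearing_payments :: "network \<Rightarrow> profile \<Rightarrow> payments \<Rightarrow> bool" where
  "clearing_payments N s P \<longleftrightarrow>
     (\<forall>i j. i \<notin> firms N \<or> j \<notin> firms N \<longrightarrow> P i j = 0) \<and>
     (\<forall>i\<in>firms N. P i i = 0) \<and>
     (\<forall>i\<in>firms N. \<forall>j\<in>firms N. 0 \<le> P i j \<and> P i j \<le> liab N i j) \<and>
     (\<forall>i\<in>firms N. out_payment N P i = min (total_liab N i) (total_assets N P i)) \<and>
     (\<forall>i\<in>firms N. \<forall>j\<in>creditors N i. P i j = priority_share N (s i) i j (out_payment N P i)) \<and>
     (\<forall>i\<in>firms N. \<forall>j\<in>firms N. liab N i j = 0 \<longrightarrow> P i j = 0)"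

definition payment_edges :: "network \<Rightarrow> payments \<Rightarrow> (nat \<times> nat) set" where
  "payment_edges N P = {(i, j). i \<in> firms N \<and> j \<in> firms N \<and> P i j > 0}"

definition proper :: "network \<Rightarrow> payments \<Rightarrow> bool" where
  "proper N P \<longleftrightarrow>
     (\<forall>i\<in>firms N. (\<exists>j\<in>firms N. P i j > 0) \<longrightarrow>
        (\<exists>k\<in>firms N. ext_assets N k > 0 \<and> (k, i) \<in> (payment_edges N P)\<^sup>*))"

definition is_maximal_clearing :: "network \<Rightarrow> profile \<Rightarrow> payments \<Rightarrow> bool" where
  "is_maximal_clearing N s P \<longleftrightarrow>
     clearing_payments N s P \<and> proper N P \<and>
     (\<forall>Q. clearing_payments N s Q \<and> proper N Q \<longrightarrow>
        (\<forall>i\<in>firms N. \<forall>j\<in>firms N. Q i j \<le> P i j))"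

text \<open>Well-defined by \<open>maximal_clearing_ex1\<close> below.\<close>

definition maximal_clearing :: "network \<Rightarrow> profile \<Rightarrow> payments" where
  "maximal_clearing N s = (THE P. is_maximal_clearing N s P)"

definition utility :: "network \<Rightarrow> profile \<Rightarrow> nat \<Rightarrow> real" where
  "utility N s i = total_assets N (maximal_clearing N s) i"

definition nash_equilibrium :: "network \<Rightarrow> profile \<Rightarrow> bool" where
  "nash_equilibrium N s \<longleftrightarrow>
     s \<in> profiles N \<and>
     (\<forall>i\<in>firms N. \<forall>c\<in>strategies N i. \<not> utility N (s(i := c)) i > utility N s i)"

definition social_welfare :: "network \<Rightarrow> payments \<Rightarrow> real" where
  "social_welfare N P = (\<Sum>i\<in>firms N. total_assets N P i)"

definition OPT :: "network \<Rightarrow> real" where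
  "OPT N = Max ((\<lambda>s. social_welfare N (maximal_clearing N s)) ` profiles N)"

text \<open>
  A denominator can vanish only if all external assets are 0; proper payments are then all 0,
  so the ratio is 0/0, which evaluates to 0.
\<close>

definition price_of_anarchy :: "network \<Rightarrow> real" where
  "price_of_anarchy N =
     Max ((\<lambda>s. OPT N / social_welfare N (maximal_clearing N s)) ` {s. nash_equilibrium N s})"


subsection \<open>Well-definedness\<close>

lemma finite_strategies: "finite (strategies N i)"
proof (rule finite_subset)
  have fc: "finite (creditors N i)" by (simp add: creditors_def firms_def)
  show "strategies N i \<subseteq> {c. set c \<subseteq> Pow (creditors N i) \<and> distinct c}"
    by (auto simp: strategies_def partition_on_def)
  show "finite {c. set c \<subseteq> Pow (creditors N i) \<and> distinct c}"
    using finite_subset_distinct[of "Pow (creditors N i)"] fc by simp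
qed

lemma strategies_nonempty: "strategies N i \<noteq> {}"
proof (cases "creditors N i = {}")
  case True
  then have "[] \<in> strategies N i" by (simp add: strategies_def partition_on_def)
  then show ?thesis by blast
next
  case False
  then have "[creditors N i] \<in> strategies N i"
    by (simp add: strategies_def partition_on_space)
  then show ?thesis by blast
qed

lemma finite_profiles: "finite (profiles N)"
  unfolding profiles_def by (rule finite_PiE) (auto simp: firms_def finite_strategies)

lemma profiles_nonempty: "profiles N \<noteq> {}"
  by (simp add: profiles_def PiE_eq_empty_iff strategies_nonempty)

lemma finite_nash_equilibria: "finite {s. nash_equilibrium N s}"
  by (rule finite_subset[OF _ finite_profiles[of N]]) (auto simp: nash_equilibrium_def)

lemma class_index_eq:
  assumes "c \<in> strategies N i" "m < length c" "j \<in> c ! m"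
  shows "class_index c j = m"
  unfolding class_index_def
proof (rule the_equality)
  show "m < length c \<and> j \<in> c ! m" using assms by simp
next
  fix k assume k: "k < length c \<and> j \<in> c ! k"
  have d: "distinct c" "disjoint (set c)" using assms(1) by (auto simp: strategies_def partition_on_def)
  show "k = m"
  proof (rule ccontr)
    assume "k \<noteq> m"
    then have "c ! k \<noteq> c ! m" using d(1) k assms(2) by (simp add: nth_eq_iff_index_eq)
    then have "c ! k \<inter> c ! m = {}" using disjointD[OF d(2)] k assms(2) by auto
    then show False using k assms(3) by blast
  qed
qed

lemma sum_over_classes:
  assumes "c \<in> strategies N i"
  shows "(\<Sum>j\<in>creditors N i. f j) = (\<Sum>m<length c. \<Sum>j\<in>c ! m. f j)"
proof -
  have d: "distinct c" "partition_on (creditors N i) (set c)"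
    using assms by (auto simp: strategies_def)
  have un: "creditors N i = (\<Union>m\<in>{..<length c}. c ! m)"
    using d(2) by (auto simp: partition_on_def set_conv_nth)
  have fin: "finite (creditors N i)" by (simp add: creditors_def firms_def)
  show ?thesis
    unfolding un
  proof (rule sum.UNION_disjoint)
    show "\<forall>m\<in>{..<length c}. finite (c ! m)"
      using fin un by (auto intro: finite_subset)
    show "\<forall>m\<in>{..<length c}. \<forall>k\<in>{..<length c}. m \<noteq> k \<longrightarrow> c ! m \<inter> c ! k = {}"
      using class_index_eq[OF assms] by (auto; metis)
  qed simp
qed

lemma class_liab_pos:
  assumes "c \<in> strategies N i" "m < length c"
  shows "class_liab N c i m > 0"
proof -
  have m: "c ! m \<subseteq> creditors N i" "c ! m \<noteq> {}"
    using assms(1) nth_mem[OF assms(2)] by (auto simp: strategies_def partition_on_def simp del: nth_mem)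
  have "finite (c ! m)"
    by (rule finite_subset[OF m(1)]) (simp add: creditors_def firms_def)
  then show ?thesis
    unfolding class_liab_def using m by (intro sum_pos) (auto simp: creditors_def)
qed

lemma total_liab_creditors:
  assumes "financial_network N" "i \<in> firms N"
  shows "total_liab N i = (\<Sum>j\<in>creditors N i. liab N i j)"
proof -
  have "liab N i j = 0" if "j \<in> firms N - creditors N i" for j
    using assms that by (auto simp: financial_network_def creditors_def not_less intro: antisym)
  then show ?thesis unfolding total_liab_def
    by (intro sum.mono_neutral_right) (auto simp: creditors_def firms_def)
qed

lemma sum_priority_share:
  assumes N: "financial_network N" "i \<in> firms N" and c: "c \<in> strategies N i"
    and x: "0 \<le> x" "x \<le> total_liab N i"
  shows "(\<Sum>j\<in>creditors N i. priority_share N c i j x) = x"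
proof -
  define C where "C m = (\<Sum>k<m. class_liab N c i k)" for m
  have row: "(\<Sum>j\<in>c ! m. priority_share N c i j x) = min x (C (Suc m)) - min x (C m)"
    if m: "m < length c" for m
  proof -
    define L where "L = class_liab N c i m"
    have L: "L > 0" unfolding L_def by (rule class_liab_pos[OF c m])
    have sub: "c ! m \<subseteq> creditors N i"
      using c m by (auto simp: strategies_def partition_on_def)
    define t where "t = min (max (x - C m) 0) L / L"
    have "priority_share N c i j x = liab N i j * t" if j: "j \<in> c ! m" for j
    proof -
      have lp: "liab N i j > 0" using j sub by (auto simp: creditors_def)
      have k: "class_index c j = m" by (rule class_index_eq[OF c m j])
      have "priority_share N c i j x = min (max ((x - C m) * (liab N i j / L)) 0) (liab N i j)"
        by (simp add: priority_share_def rel_liab_def k C_def L_def)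
      also have "\<dots> = liab N i j * t"
      proof -
        define r where "r = liab N i j / L"
        have r: "r > 0" "liab N i j = L * r" using lp L by (auto simp: r_def)
        have "min (max ((x - C m) * r) 0) (L * r) = min (max (x - C m) 0) L * r"
          using r(1) by (simp add: min_mult_distrib_right max_mult_distrib_right)
        then show ?thesis using L by (simp add: t_def r_def)
      qed
      finally show ?thesis .
    qed
    then have "(\<Sum>j\<in>c ! m. priority_share N c i j x) = L * t"
      by (simp add: L_def class_liab_def sum_distrib_right)
    also have "\<dots> = min (max (x - C m) 0) L" using L by (simp add: t_def)
    also have "\<dots> = min x (C (Suc m)) - min x (C m)"
      using L by (auto simp: C_def L_def min_def max_def)
    finally show ?thesis .
  qed
  have "(\<Sum>j\<in>creditors N i. priority_share N c i j x)
      = (\<Sum>m<length c. min x (C (Suc m)) - min x (C m))"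
    unfolding sum_over_classes[OF c] by (intro sum.cong) (auto simp: row)
  also have "\<dots> = min x (C (length c)) - min x (C 0)"
    by (rule sum_lessThan_telescope)
  also have "C (length c) = total_liab N i"
    unfolding total_liab_creditors[OF N] sum_over_classes[OF c] by (simp add: C_def class_liab_def)
  also have "C 0 = 0" by (simp add: C_def)
  finally show ?thesis using x by simp
qed

lemma priority_share_bounds:
  assumes "j \<in> creditors N i"
  shows "0 \<le> priority_share N c i j x" "priority_share N c i j x \<le> liab N i j"
  using assms by (auto simp: priority_share_def creditors_def)

lemma priority_share_mono:
  assumes c: "c \<in> strategies N i" and j: "j \<in> creditors N i" and xy: "x \<le> y"
  shows "priority_share N c i j x \<le> priority_share N c i j y"
proof -
  obtain m where m: "m < length c" "j \<in> c ! m"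
    using c j by (auto simp: strategies_def partition_on_def set_conv_nth)
  have "rel_liab N c i j \<ge> 0"
    using j class_liab_pos[OF c m(1)] class_index_eq[OF c m]
    by (simp add: rel_liab_def creditors_def)
  then show ?thesis
    unfolding priority_share_def using xy
    by (intro min.mono max.mono mult_right_mono) auto
qed

lemma maximal_clearing_exists:
  assumes N: "financial_network N" and s: "s \<in> profiles N"
  shows "\<exists>P. is_maximal_clearing N s P"
proof -
  have fin: "finite (firms N)" by (simp add: firms_def)
  have st: "s i \<in> strategies N i" if "i \<in> firms N" for i
    using s that by (auto simp: profiles_def)
  have e0: "ext_assets N i \<ge> 0" if "i \<in> firms N" for i
    using N that by (auto simp: financial_network_def)
  have l0: "liab N i j \<ge> 0" if "i \<in> firms N" "j \<in> firms N" for i j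
    using N that by (auto simp: financial_network_def)
  have L0: "total_liab N i \<ge> 0" if "i \<in> firms N" for i
    unfolding total_liab_def using l0 that by (intro sum_nonneg) auto
  define F where "F Q i j = (if i \<in> firms N \<and> j \<in> creditors N i
      then priority_share N (s i) i j (min (total_liab N i) (total_assets N Q i)) else 0)"
    for Q :: payments and i j
  have cred: "j \<in> firms N" if "j \<in> creditors N i" for i j
    using that by (simp add: creditors_def)
  have Fb: "0 \<le> F Q i j" "i \<in> firms N \<Longrightarrow> j \<in> firms N \<Longrightarrow> F Q i j \<le> liab N i j" for Q i j
    using priority_share_bounds[of j N i] l0 by (auto simp: F_def)
  have Fmono: "F Q i j \<le> F Q' i j" if "\<And>i j. Q i j \<le> Q' i j" for Q Q' i j
  proof (cases "i \<in> firms N \<and> j \<in> creditors N i")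
    case True
    have "total_assets N Q i \<le> total_assets N Q' i"
      unfolding total_assets_def using that by (simp add: sum_mono)
    then show ?thesis
      using True unfolding F_def by (auto intro!: priority_share_mono st)
  qed (auto simp: F_def)
  have reach_mono: "(payment_edges N Q)\<^sup>* \<subseteq> (payment_edges N Q')\<^sup>*"
    if "\<And>i j. Q i j \<le> Q' i j" for Q Q'
    using that by (intro rtrancl_mono) (auto simp: payment_edges_def intro: less_le_trans)
  define S where "S = {Q. (\<forall>i j. i \<notin> firms N \<or> j \<notin> firms N \<longrightarrow> Q i j = 0) \<and>
      (\<forall>i j. 0 \<le> Q i j \<and> Q i j \<le> F Q i j) \<and> proper N Q}"
  define P where "P i j = (SUP Q\<in>S. Q i j)" for i j
  have Z: "(\<lambda>i j. 0) \<in> S" by (auto simp: S_def Fb proper_def)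
  have bdd: "bdd_above ((\<lambda>Q. Q i j) ` S)" for i j
  proof (cases "i \<in> firms N \<and> j \<in> firms N")
    case True
    show ?thesis
    proof (rule bdd_aboveI2[of _ _ "liab N i j"])
      fix Q assume "Q \<in> S"
      then have "Q i j \<le> F Q i j" by (simp add: S_def)
      then show "Q i j \<le> liab N i j" using Fb(2)[of i j Q] True by linarith
    qed
  next
    case False
    then show ?thesis by (intro bdd_aboveI2[of _ _ 0]) (auto simp: S_def)
  qed
  have up: "Q i j \<le> P i j" if "Q \<in> S" for Q i j
    unfolding P_def using that bdd by (rule cSUP_upper)
  have P0: "0 \<le> P i j" for i j using up[OF Z] by simp
  have Pout: "P i j = 0" if "i \<notin> firms N \<or> j \<notin> firms N" for i j
  proof (rule antisym)
    show "P i j \<le> 0" unfolding P_def using Z that by (intro cSUP_least) (auto simp: S_def)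
  qed (rule P0)
  have PF: "P i j \<le> F P i j" for i j
    unfolding P_def
  proof (rule cSUP_least)
    fix Q assume Q: "Q \<in> S"
    have "Q i j \<le> F Q i j" using Q by (simp add: S_def)
    also have "\<dots> \<le> F P i j" by (rule Fmono) (rule up[OF Q])
    finally show "Q i j \<le> F (\<lambda>i j. SUP Q\<in>S. Q i j) i j" by (simp add: P_def[abs_def])
  qed (use Z in auto)
  have reach: "\<exists>k\<in>firms N. ext_assets N k > 0 \<and> (k, i) \<in> (payment_edges N P)\<^sup>*"
    if ij: "i \<in> firms N" "j \<in> firms N" "P i j > 0" for i j
  proof -
    obtain Q where Q: "Q \<in> S" "Q i j > 0"
      using ij(3) less_cSUP_iff[OF _ bdd, of 0 i j] Z unfolding P_def by blast
    then obtain k where k: "k \<in> firms N" "ext_assets N k > 0" "(k, i) \<in> (payment_edges N Q)\<^sup>*"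
      using ij unfolding S_def proper_def by blast
    then show ?thesis using reach_mono[of Q P] up[OF Q(1)] by blast
  qed
  have properP: "proper N P" using reach by (auto simp: proper_def)
  have FPS: "F P \<in> S"
  proof -
    have "\<exists>k\<in>firms N. ext_assets N k > 0 \<and> (k, i) \<in> (payment_edges N (F P))\<^sup>*"
      if ij: "i \<in> firms N" "j \<in> firms N" "F P i j > 0" for i j
    proof (cases "ext_assets N i > 0")
      case True
      then show ?thesis using ij by blast
    next
      case False
      have j: "j \<in> creditors N i" using ij by (auto simp: F_def split: if_splits)
      have "total_assets N P i > 0"
      proof (rule ccontr)
        assume "\<not> ?thesis"
        moreover have "total_assets N P i \<ge> 0"
          unfolding total_assets_def using e0 ij P0 by (simp add: sum_nonneg)
        ultimately have a: "total_assets N P i = 0" by simp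
        have "(\<Sum>j\<in>creditors N i. priority_share N (s i) i j 0) = 0"
          by (rule sum_priority_share[OF N ij(1) st]) (use ij L0 in auto)
        moreover have "finite (creditors N i)" using fin by (simp add: creditors_def)
        ultimately have "priority_share N (s i) i j 0 = 0"
          using j priority_share_bounds(1)[of _ N i] by (simp add: sum_nonneg_eq_0_iff)
        then show False using ij(3) a L0[OF ij(1)] by (simp add: F_def split: if_splits)
      qed
      then have "(\<Sum>k\<in>firms N. P k i) > 0" using False e0[OF ij(1)] by (simp add: total_assets_def)
      then obtain k where k: "k \<in> firms N" "P k i > 0"
        by (meson not_less sum_nonpos)
      obtain h where h: "h \<in> firms N" "ext_assets N h > 0" "(h, k) \<in> (payment_edges N P)\<^sup>*"
        using reach[OF k(1) ij(1) k(2)] by blast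
      have "(k, i) \<in> payment_edges N P" using k ij by (simp add: payment_edges_def)
      with h(3) have "(h, i) \<in> (payment_edges N P)\<^sup>*" by (rule rtrancl_into_rtrancl)
      then show ?thesis using h reach_mono[of P "F P"] PF by blast
    qed
    then have "proper N (F P)" by (auto simp: proper_def)
    moreover have "F P i j \<le> F (F P) i j" for i j by (rule Fmono) (rule PF)
    moreover have "F P i j = 0" if "i \<notin> firms N \<or> j \<notin> firms N" for i j
      using that cred by (auto simp: F_def)
    ultimately show ?thesis by (simp add: S_def Fb)
  qed
  have eq: "P i j = F P i j" for i j using PF up[OF FPS] by (intro antisym) auto
  have a0: "total_assets N P i \<ge> 0" if "i \<in> firms N" for i
    unfolding total_assets_def using e0 that P0 by (simp add: sum_nonneg)
  have out: "out_payment N P i = min (total_liab N i) (total_assets N P i)" if i: "i \<in> firms N" for i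
  proof -
    have "out_payment N P i = (\<Sum>j\<in>creditors N i. P i j)"
      unfolding out_payment_def using fin eq
      by (intro sum.mono_neutral_right) (auto simp: creditors_def F_def)
    also have "\<dots> = (\<Sum>j\<in>creditors N i.
        priority_share N (s i) i j (min (total_liab N i) (total_assets N P i)))"
      using i by (intro sum.cong refl) (simp add: eq[of i] F_def)
    also have "\<dots> = min (total_liab N i) (total_assets N P i)"
      by (rule sum_priority_share[OF N i st[OF i]]) (use L0 a0 i in auto)
    finally show ?thesis .
  qed
  have share: "P i j = priority_share N (s i) i j (out_payment N P i)"
    if "i \<in> firms N" "j \<in> creditors N i" for i j
    using that by (simp add: eq[of i j] F_def out)
  have zero: "P i j = 0" if "i \<in> firms N" "liab N i j = 0" for i j
    using that by (simp add: eq[of i j] F_def creditors_def)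
  have le: "P i j \<le> liab N i j" if "i \<in> firms N" "j \<in> firms N" for i j
    using that by (simp add: eq[of i j] Fb)
  have diag: "P i i = 0" if "i \<in> firms N" for i
    using that N by (intro zero) (auto simp: financial_network_def)
  have "clearing_payments N s P"
    unfolding clearing_payments_def using Pout diag P0 le out share zero by blast
  moreover have "Q i j \<le> P i j" if Q: "clearing_payments N s Q" "proper N Q" for Q i j
  proof -
    have FQ: "F Q h k = Q h k" for h k
    proof (cases "h \<in> firms N \<and> k \<in> firms N")
      case True
      show ?thesis
      proof (cases "k \<in> creditors N h")
        case True
        then show ?thesis using \<open>h \<in> firms N \<and> k \<in> firms N\<close> Q(1)
          by (simp add: F_def clearing_payments_def)
      next
        case False
        then have "liab N h k = 0"
          using True l0[of h k] by (auto simp: creditors_def)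
        then show ?thesis using False True Q(1) by (simp add: F_def clearing_payments_def)
      qed
    next
      case False
      then show ?thesis using Q(1) cred by (auto simp: F_def clearing_payments_def)
    qed
    have "Q \<in> S" using Q Fb(1)[of Q] by (auto simp: S_def clearing_payments_def FQ)
    then show ?thesis by (rule up)
  qed
  ultimately have "is_maximal_clearing N s P"
    unfolding is_maximal_clearing_def using properP by blast
  then show ?thesis by blast
qed

lemma maximal_clearing_unique:
  assumes P: "is_maximal_clearing N s P" and Q: "is_maximal_clearing N s Q"
  shows "P = Q"
proof (intro ext)
  fix i j
  show "P i j = Q i j"
  proof (cases "i \<in> firms N \<and> j \<in> firms N")
    case True
    then show ?thesis using P Q unfolding is_maximal_clearing_def by (meson antisym)
  next
    case False
    then have out: "R i j = 0" if "is_maximal_clearing N s R" for R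
      using that unfolding is_maximal_clearing_def clearing_payments_def by blast
    show ?thesis using out[OF P] out[OF Q] by simp
  qed
qed

lemma maximal_clearing_eqI:
  assumes "is_maximal_clearing N s P"
  shows "maximal_clearing N s = P"
  unfolding maximal_clearing_def
  using assms maximal_clearing_unique by blast

lemma maximal_clearing_ex1:
  assumes "financial_network N" "s \<in> profiles N"
  shows "\<exists>!P. is_maximal_clearing N s P"
  using maximal_clearing_exists[OF assms] maximal_clearing_unique by blast

end

theory Submission imports Defs begin

text \<open>
  Firm 0 owns the only external asset, 1, and owes 1 to each of the firms 1 and 3; the firms 1 and
  2 owe \<open>M\<close> to each other.  Firm 0 has no debtors and is therefore indifferent between its
  strategies, while every other firm has at most one creditor and thus no choice: every profile is
  an equilibrium.  If firm 0 pays firm 1 first, the cycle between 1 and 2 clears in full and the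
  welfare exceeds \<open>2 * M\<close>.  If it pays firm 3 first, nothing reaches the cycle, properness forces
  its payments to be 0, and the welfare is at most 2.
\<close>

definition cycle_network :: "real \<Rightarrow> network" where
  "cycle_network M =
     \<lparr>num_firms = 4,
      ext_assets = (\<lambda>i. if i = 0 then 1 else 0),
      liab = (\<lambda>i j. if i = 0 \<and> (j = 1 \<or> j = 3) then 1
                    else if i = 1 \<and> j = 2 \<or> i = 2 \<and> j = 1 then M else 0)\<rparr>"

text \<open>Only firm 0's ordering varies, the others being forced. The restriction to
  \<open>{..<4}\<close> makes the function extensional, as membership in \<open>profiles\<close>
  demands.\<close>

definition cycle_profile :: "strategy \<Rightarrow> profile" where
  "cycle_profile c = (\<lambda>i\<in>{..<4}. if i = 0 then c else if i = 1 then [{2}]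
                                 else if i = 2 then [{1}] else [])"

lemma total_assets_mono:
  assumes "\<And>i j. i \<in> firms N \<Longrightarrow> j \<in> firms N \<Longrightarrow> Q i j \<le> P i j" "i \<in> firms N"
  shows "total_assets N Q i \<le> total_assets N P i"
  unfolding total_assets_def using assms by (simp add: sum_mono)

text \<open>An empty creditor set admits only the empty list, and a single creditor only the list
  with one class. For the firms 1, 2 and 3 this reduces every deviation to the strategy already
  played.\<close>

lemma strategies_eq_if_creditors_subset_singleton:
  assumes sub: "creditors N i \<subseteq> {x}" and c: "c \<in> strategies N i" and d: "d \<in> strategies N i"
  shows "c = d"
proof -
  have *: "b = (if creditors N i = {} then [] else [{x}])" if b: "b \<in> strategies N i" for b
  proof (cases "creditors N i = {}")
    case True
    then have "set b = {}" using b by (simp add: strategies_def partition_on_empty)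
    then show ?thesis using True by simp
  next
    case False
    then have "\<Union> (set b) = {x}" "{} \<notin> set b"
      using sub b by (auto simp: strategies_def partition_on_def)
    then have "set b = {{x}}"
      by (metis Sup_empty Union_upper insert_not_empty subset_singletonD subset_singleton_iff
          subsetI singletonI)
    moreover have "distinct b" using b by (simp add: strategies_def)
    \<comment> \<open>Distinctness excludes lists that repeat the class \<open>{x}\<close>.\<close>
    ultimately have "b = [{x}]"
      by (cases b; cases "tl b") auto
    then show ?thesis using False by simp
  qed
  show ?thesis using *[OF c] *[OF d] by simp
qed

lemma is_maximal_clearing_maximal_clearing:
  assumes "financial_network N" "s \<in> profiles N"
  shows "is_maximal_clearing N s (maximal_clearing N s)"
  using maximal_clearing_ex1[OF assms] maximal_clearing_eqI by metis

context
  fixes M :: real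
  assumes M: "M > 0"
begin

private abbreviation "N \<equiv> cycle_network M"

lemma cycle_firms: "firms N = {0, 1, 2, 3}"
  by (auto simp: firms_def cycle_network_def)

lemma cycle_ext: "ext_assets N i = (if i = 0 then 1 else 0)"
  by (simp add: cycle_network_def)

lemma cycle_liab:
  "liab N i j = (if i = 0 \<and> (j = 1 \<or> j = 3) then 1
                 else if i = 1 \<and> j = 2 \<or> i = 2 \<and> j = 1 then M else 0)"
  by (simp add: cycle_network_def)

lemma cycle_creditors:
  "creditors N 0 = {1, 3}" "creditors N 1 = {2}" "creditors N 2 = {1}" "creditors N 3 = {}"
  using M by (auto simp: creditors_def cycle_firms cycle_liab)

lemma financial_cycle_network: "financial_network N"
  using M by (auto simp: financial_network_def cycle_firms cycle_liab cycle_ext)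

lemma cycle_profile_mem: "c \<in> strategies N 0 \<Longrightarrow> cycle_profile c \<in> profiles N"
  unfolding profiles_def cycle_profile_def cycle_firms
  by (rule PiE_I)
     (auto simp: strategies_def cycle_creditors cycle_creditors(2)[simplified] partition_on_def)

lemma cycle_strategies: "[{3}, {1}] \<in> strategies N 0" "[{1}, {3}] \<in> strategies N 0"
  by (auto simp: strategies_def cycle_creditors partition_on_def disjoint_def)

text \<open>No firm owes firm 0 anything, so its incoming payments are squeezed between 0 and 0 and
  its assets reduce to its external asset.\<close>

lemma cycle_utility_source:
  assumes "s \<in> profiles N"
  shows "utility N s 0 = 1"
proof -
  let ?P = "maximal_clearing N s"
  have "\<forall>j\<in>firms N. 0 \<le> ?P j 0 \<and> ?P j 0 \<le> liab N j 0"
    using is_maximal_clearing_maximal_clearing[OF financial_cycle_network assms]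
    by (auto simp: is_maximal_clearing_def clearing_payments_def cycle_firms)
  then have "\<forall>j\<in>firms N. ?P j 0 = 0" by (auto simp: cycle_liab intro: antisym)
  then show ?thesis by (simp add: utility_def total_assets_def cycle_ext)
qed

lemma cycle_nash:
  assumes s: "s \<in> profiles N"
  shows "nash_equilibrium N s"
  unfolding nash_equilibrium_def
proof (intro conjI ballI s)
  fix i c
  assume i: "i \<in> firms N" and c: "c \<in> strategies N i"
  have si: "s i \<in> strategies N i" using s i by (auto simp: profiles_def)
  show "\<not> utility N (s(i := c)) i > utility N s i"
  proof (cases "i = 0")
    case True
    have "s(i := c) \<in> profiles N"
      using s i c unfolding profiles_def by (metis PiE_fun_upd insert_absorb)
    then show ?thesis using True cycle_utility_source s by simp
  next
    case False
    then have "\<exists>x. creditors N i \<subseteq> {x}"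
      using i cycle_creditors by (auto simp: cycle_firms)
    then have "c = s i"
      using strategies_eq_if_creditors_subset_singleton c si by metis
    then show ?thesis by simp
  qed
qed

text \<open>The upper bound makes this equilibrium poor; the lower bound makes it a legitimate
  positive denominator in the price of anarchy.\<close>

lemma cycle_welfare_sink_first:
  assumes s: "s = cycle_profile [{3}, {1}]"
  shows "social_welfare N (maximal_clearing N s) \<in> {1..2}"
proof -
  define P where "P = maximal_clearing N s"
  have "is_maximal_clearing N s P"
    unfolding P_def s
    by (intro is_maximal_clearing_maximal_clearing financial_cycle_network cycle_profile_mem
        cycle_strategies)
  then have cl: "clearing_payments N s P" and pr: "proper N P"
    by (auto simp: is_maximal_clearing_def)
  have b: "0 \<le> P i j" "P i j \<le> liab N i j" if "i \<in> firms N" "j \<in> firms N" for i j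
    using cl that by (auto simp: clearing_payments_def)
  have ta: "total_assets N P 0 = 1"
    using cycle_utility_source[OF cycle_profile_mem[OF cycle_strategies(1)]]
    by (simp add: utility_def P_def s)
  have out: "out_payment N P 0 = 1"
    using cl ta by (simp add: clearing_payments_def total_liab_def cycle_firms cycle_liab)
  \<comment> \<open>Indices start at 0, so firm 1 sits in the second class. The class before it has
    liability 1 and absorbs the whole payment of firm 0.\<close>
  have "class_index [{3}, {1}] 1 = 1"
    by (rule class_index_eq[OF cycle_strategies(1)]) auto
  then have "priority_share N (s 0) 0 1 1 = 0"
    by (simp add: priority_share_def s cycle_profile_def class_liab_def cycle_liab)
  then have P01: "P 0 1 = 0"
    using cl out by (simp add: clearing_payments_def cycle_firms cycle_creditors)
  have zero: "P i j = 0" if "i \<in> firms N" "j \<in> firms N" "liab N i j = 0" for i j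
    using cl that by (simp add: clearing_payments_def)
  \<comment> \<open>Payment edges follow positive liabilities. From firm 0 these lead to 1 and 3;
    \<open>P01\<close> removes the former, and firm 3 is a dead end.\<close>
  have unreach: "i \<in> {0, 3}" if "(0, i) \<in> (payment_edges N P)\<^sup>*" for i
    using that
  proof (induction rule: rtrancl_induct)
    case (step y z)
    then have "y \<in> firms N" "z \<in> firms N" "P y z > 0" by (auto simp: payment_edges_def)
    moreover from this have "liab N y z > 0" using b(2) less_le_trans by blast
    ultimately show ?case
      using step.IH P01 by (auto simp: cycle_liab split: if_splits)
  qed simp
  \<comment> \<open>By properness, a paying firm 1 or 2 would be reachable from firm 0, the only
    holder of external assets.\<close>
  have cyc: "P i j = 0" if ij: "i \<in> {1, 2}" "j \<in> firms N" for i j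
  proof (rule ccontr)
    assume "P i j \<noteq> 0"
    then have "P i j > 0" using b(1)[of i j] ij by (force simp: cycle_firms)
    moreover have "i \<in> firms N" using ij by (auto simp: cycle_firms)
    ultimately obtain k where "ext_assets N k > 0" "(k, i) \<in> (payment_edges N P)\<^sup>*"
      using pr ij(2) unfolding proper_def by blast
    then show False using unreach[of i] ij(1) by (auto simp: cycle_ext split: if_splits)
  qed
  have "social_welfare N P = 1 + P 0 3"
    unfolding social_welfare_def total_assets_def
    using P01 cyc[of 1] cyc[of 2] zero[of 3] zero[of 0]
    by (simp add: cycle_firms cycle_ext cycle_liab)
  then show ?thesis
    using b[of 0 3] by (simp add: P_def cycle_firms cycle_liab)
qed

text \<open>One proper clearing matrix suffices: the maximal payments dominate it entrywise, and
  welfare is monotone in the payments.\<close>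

lemma cycle_welfare_cycle_first:
  assumes s: "s = cycle_profile [{1}, {3}]"
  shows "social_welfare N (maximal_clearing N s) \<ge> 2 * M"
proof -
  \<comment> \<open>Firm 0 passes its unit to firm 1, and the cycle clears in full. Firm 1 has
    assets \<open>1 + M\<close> and firm 2 has \<open>M\<close>, so both can pay \<open>M\<close>;
    the welfare is \<open>2 + 2 * M\<close>.\<close>
  define Q :: payments where
    "Q i j = (if i = 0 \<and> j = 1 then 1
              else if i = 1 \<and> j = 2 \<or> i = 2 \<and> j = 1 then M else 0)" for i j
  have idx: "class_index [{1}, {3}] 1 = 0" "class_index [{1}, {3}] 3 = 1"
    by (rule class_index_eq[OF cycle_strategies(2)]; simp)+
  have sp: "s \<in> profiles N" unfolding s by (intro cycle_profile_mem cycle_strategies)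
  have "[{2}] \<in> strategies N 1" "[{1}] \<in> strategies N 2"
    by (auto simp: strategies_def cycle_creditors cycle_creditors(2)[simplified] partition_on_def)
  then have idx': "class_index [{2}] 2 = 0" "class_index [{1}] 1 = 0"
    by (auto intro!: class_index_eq)
  have share: "Q i j = priority_share N (s i) i j (out_payment N Q i)"
    if "i \<in> firms N" "j \<in> creditors N i" for i j
  proof -
    have out: "out_payment N Q 0 = 1" "out_payment N Q 1 = M" "out_payment N Q 2 = M"
      by (simp_all add: out_payment_def cycle_firms Q_def)
    have prof: "s 0 = [{1}, {3}]" "s 1 = [{2}]" "s 2 = [{1}]"
      by (simp_all add: s cycle_profile_def)
    have "i = 0 \<and> j = 1 \<or> i = 0 \<and> j = 3 \<or> i = 1 \<and> j = 2 \<or> i = 2 \<and> j = 1"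
      using that cycle_creditors unfolding cycle_firms by blast
    then show ?thesis
    proof (elim disjE conjE)
      assume ij: "i = 0" "j = 1"
      show ?thesis
        unfolding ij priority_share_def rel_liab_def out prof idx class_liab_def
        by (simp add: Q_def cycle_liab)
    next
      \<comment> \<open>The class of firm 1 uses up the payment 1, leaving a remainder of 0 for firm
        3.\<close>
      assume ij: "i = 0" "j = 3"
      show ?thesis
        unfolding ij priority_share_def rel_liab_def out prof idx class_liab_def
        by (simp add: Q_def cycle_liab)
    next
      assume ij: "i = 1" "j = 2"
      show ?thesis
        unfolding ij priority_share_def rel_liab_def out prof idx' class_liab_def
        using M by (simp add: Q_def cycle_liab)
    next
      assume ij: "i = 2" "j = 1"
      show ?thesis
        unfolding ij priority_share_def rel_liab_def out prof idx' class_liab_def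
        using M by (simp add: Q_def cycle_liab)
    qed
  qed
  have clearing: "clearing_payments N s Q"
    unfolding clearing_payments_def
    using M share
    by (auto simp: cycle_firms cycle_liab Q_def out_payment_def total_liab_def total_assets_def
        cycle_ext)
  \<comment> \<open>The unit paid to firm 1 connects both cycle firms to an external asset, which
    makes their mutual payments proper.\<close>
  have e: "(0, 1) \<in> payment_edges N Q" "(1, 2) \<in> payment_edges N Q"
    using M by (auto simp: payment_edges_def Q_def cycle_firms)
  have r: "(0, 2) \<in> (payment_edges N Q)\<^sup>*"
    using e by (meson r_into_rtrancl rtrancl.rtrancl_into_rtrancl)
  have "proper N Q"
    unfolding proper_def
  proof (intro ballI impI)
    fix i assume "i \<in> firms N" "\<exists>j\<in>firms N. Q i j > 0"
    then have "i = 0 \<or> i = 1 \<or> i = 2" by (auto simp: Q_def split: if_splits)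
    then have "(0, i) \<in> (payment_edges N Q)\<^sup>*" using e r by auto
    then show "\<exists>k\<in>firms N. ext_assets N k > 0 \<and> (k, i) \<in> (payment_edges N Q)\<^sup>*"
      by (auto simp: cycle_ext cycle_firms)
  qed
  then have "Q i j \<le> maximal_clearing N s i j" if "i \<in> firms N" "j \<in> firms N" for i j
    using is_maximal_clearing_maximal_clearing[OF financial_cycle_network sp] clearing that
    by (auto simp: is_maximal_clearing_def)
  then have "social_welfare N Q \<le> social_welfare N (maximal_clearing N s)"
    unfolding social_welfare_def by (intro sum_mono total_assets_mono)
  moreover have "social_welfare N Q \<ge> 2 * M"
    by (simp add: social_welfare_def total_assets_def cycle_firms cycle_ext Q_def)
  ultimately show ?thesis by simp
qed

text \<open>The profile \<open>t\<close> bounds the optimum below by \<open>2 * M\<close>, while the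
  equilibrium \<open>s\<close> has welfare at most 2.\<close>

lemma cycle_price_of_anarchy: "price_of_anarchy N \<ge> M"
proof -
  define s t where "s = cycle_profile [{3}, {1}]" and "t = cycle_profile [{1}, {3}]"
  have st: "s \<in> profiles N" "t \<in> profiles N"
    unfolding s_def t_def by (intro cycle_profile_mem cycle_strategies)+
  let ?W = "\<lambda>s. social_welfare N (maximal_clearing N s)"
  have "2 * M \<le> ?W t" using cycle_welfare_cycle_first t_def by simp
  also have "?W t \<le> OPT N"
    unfolding OPT_def using st finite_profiles by (intro Max_ge) auto
  finally have O: "2 * M \<le> OPT N" .
  have W: "1 \<le> ?W s" "?W s \<le> 2" using cycle_welfare_sink_first[OF s_def] by auto
  have "M * ?W s \<le> M * 2" using W M by (intro mult_left_mono) auto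
  then have "M \<le> OPT N / ?W s" using W O by (simp add: field_simps)
  also have "\<dots> \<le> price_of_anarchy N"
    unfolding price_of_anarchy_def
    using cycle_nash[OF st(1)] finite_nash_equilibria by (intro Max_ge) auto
  finally show ?thesis .
qed

end

theorem theorem9:
  fixes R :: real
  assumes "R > 0"
  shows "\<exists>N. financial_network N \<and> (\<exists>s. nash_equilibrium N s) \<and> price_of_anarchy N \<ge> R"
proof (intro exI conjI)
  \<comment> \<open>The cycle liability is chosen as \<open>R\<close> itself, since the ratio is at
    least that liability.\<close>
  show "financial_network (cycle_network R)" by (rule financial_cycle_network[OF assms])
  show "nash_equilibrium (cycle_network R) (cycle_profile [{3}, {1}])"
    by (intro cycle_nash cycle_profile_mem cycle_strategies assms)
  show "price_of_anarchy (cycle_network R) \<ge> R" by (rule cycle_price_of_anarchy[OF assms])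
qed

end
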